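(* Let $\delta\in(0,(\beta_0-\alpha_0)/2)$, $r\in\mathcal R_\delta=[\alpha_0+\delta,\beta_0-\delta]$, and let $z_{\varepsilon r}$ denote the Maxwell solution (defined for all sufficiently small $\varepsilon>0$). Its energy $E^0_{\varepsilon r}:=E_\varepsilon[z_{\varepsilon r}]$ has the asymptotic form $$E^0_{\varepsilon r}=2(\sigma_0r+b_0)+\varepsilon c_\varepsilon+\mathcal O(\exp(-C/\varepsilon))\qquad\text{as }\varepsilon\to0^+,$$ for some constant $C>0$, where $$c_\varepsilon:=\int_{\alpha_0}^{\beta_0}\sqrt{\left[F(s)-F(\beta_0)-\sigma_0(s-\beta_0)\right]\left[2-\varepsilon^2\bigl(F(s)-F(\beta_0)-\sigma_0(s-\beta_0)\bigr)\right]}\,ds.$$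
   Context: $Q(s)=\sqrt{1+s^2}-1$. Fix $0<\overline\alpha<\underline\beta$ and $F\in C^5(0,\infty)$ (real valued) with $F''>0$ on $(0,\overline\alpha)\cup(\underline\beta,\infty)$, $F''<0$ on $(\overline\alpha,\underline\beta)$, $F'(0)<F'(\underline\beta)$ and $F'(\infty)>F'(\overline\alpha)$, where $F'(0),F'(\infty)$ denote the limits of $F'$ at $0^+$ and $+\infty$. Put $\underline\sigma:=F'(\underline\beta)$, $\overline\sigma:=F'(\overline\alpha)$ and, for $\sigma\in[\underline\sigma,\overline\sigma]$, let $\Phi_\sigma(z):=F(z)-\sigma z$. Its critical points are $\alpha_\sigma\le\zeta_\sigma\le\beta_\sigma$, the solutions of $F'(\cdot)=\sigma$ in $(0,\overline\alpha]$, $[\overline\alpha,\underline\beta]$, $[\underline\beta,\infty)$ respectively. The value $\sigma_0\in(\underline\sigma,\overline\sigma)$ is the unique one for which $\Phi_{\sigma_0}(\alpha_{\sigma_0})=\Phi_{\sigma_0}(\beta_{\sigma_0})$; write $\alpha_0=\alpha_{\sigma_0}$, $\beta_0=\beta_{\sigma_0}$, $b_0=\Phi_{\sigma_0}(\alpha_0)=\Phi_{\sigma_0}(\beta_0)$, $\Delta_0=(\sigma_0,b_0)$ (Maxwell point). A pair $\Delta=(\sigma,b)$ is admissible if $\sigma\in(\underline\sigma,\overline\sigma)$ and $\max\{\Phi_\sigma(\alpha_\sigma),\Phi_\sigma(\beta_\sigma)\}<b<\Phi_\sigma(\zeta_\sigma)$. Consider the problem: find a positive function $z$ and $\sigma\in\mathbb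 R$ with $Q''(\varepsilon z')z''=F'(z)-\sigma$ in $(-\varepsilon^{-1},\varepsilon^{-1})$, $z'(\pm\varepsilon^{-1})=0$, $\int_{-\varepsilon^{-1}}^{\varepsilon^{-1}}z\,dx=2r\varepsilon^{-1}$. A simple solution is a (non-constant) increasing solution; it satisfies $P_\varepsilon(z')=\Phi_\sigma(z)-b$ for a constant $b$, with $P_\varepsilon(s)=\varepsilon^{-2}\bigl(1-\tfrac{1}{\sqrt{1+\varepsilon^2s^2}}\bigr)$, and its corresponding admissible pair is $\Delta=(\sigma,b)$. Maxwell solution: for every $\delta\in(0,(\beta_0-\alpha_0)/2)$ there exist $\varepsilon_\delta>0$ and a neighborhood $\mathcal N_\delta$ of $\Delta_0$ such that for $\varepsilon\in(0,\varepsilon_\delta)$ and $r\in\mathcal R_\delta$ there is exactly one simple solution whose admissible pair $\Delta(\varepsilon,r)$ lies in $\mathcal N_\delta$, and $\Delta(\varepsilon,r)=\Delta_0+O(\exp(-C/\varepsilon))$ as $\varepsilon\to0^+$ uniformly in $r\in\mathcal R_\delta$, for some $C=C_\delta>0$. This solution is the Maxwell solution $z_{\varepsilon r}$. The energy is $E_\varepsilon[z]=\varepsilon\int_{-\varepsilon^{-1}}^{\varepsilon^{-1}}\left[\frac{Q(\varepsilon z'(t))}{\varepsilon^2}+F(z(t))\right]dt$. *)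

theory Defs
  imports "HOL-Analysis.Analysis"
begin

definition Qfun :: "real \<Rightarrow> real" where
  "Qfun s = sqrt (1 + s\<^sup>2) - 1"

definition Pfun :: "real \<Rightarrow> real \<Rightarrow> real" where
  "Pfun \<epsilon> s = (1 - 1 / sqrt (1 + \<epsilon>\<^sup>2 * s\<^sup>2)) / \<epsilon>\<^sup>2"

text \<open>
  Throughout, \<open>A\<close> and \<open>B\<close> are the two inflection points of \<open>F\<close> (written
  \<open>\<alpha>\<close>-bar and \<open>\<beta>\<close>-underbar in the literature). Only the values of \<open>F\<close> on
  \<open>(0, \<infinity>)\<close> matter. The limits of \<open>F'\<close> at \<open>0\<close> and \<open>\<infinity>\<close> exist by monotonicity of
  \<open>F'\<close> but may be infinite, so they are taken in the extended reals.
\<close>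

definition double_well :: "(real \<Rightarrow> real) \<Rightarrow> real \<Rightarrow> real \<Rightarrow> bool" where
  "double_well F A B \<longleftrightarrow>
     0 < A \<and> A < B \<and>
     (\<forall>k<5. \<forall>x>0. (deriv ^^ k) F differentiable (at x)) \<and>
     continuous_on {0<..} ((deriv ^^ 5) F) \<and>
     (\<forall>x\<in>{0<..<A} \<union> {B<..}. (deriv ^^ 2) F x > 0) \<and>
     (\<forall>x\<in>{A<..<B}. (deriv ^^ 2) F x < 0) \<and>
     (\<exists>l. ((\<lambda>x. ereal (deriv F x)) \<longlongrightarrow> l) (at_right 0) \<and> l < ereal (deriv F B)) \<and>
     (\<exists>l. ((\<lambda>x. ereal (deriv F x)) \<longlongrightarrow> l) at_top \<and> l > ereal (deriv F A))"

definition Phi :: "(real \<Rightarrow> real) \<Rightarrow> real \<Rightarrow> real \<Rightarrow> real" where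
  "Phi F \<sigma> z = F z - \<sigma> * z"

text \<open>
  The critical points of \<^term>\<open>Phi F \<sigma>\<close>. Under \<^const>\<open>double_well\<close> the descriptions are
  well defined for \<open>\<sigma>\<close> between \<^term>\<open>deriv F B\<close> and \<^term>\<open>deriv F A\<close>.
\<close>

definition alpha_at :: "(real \<Rightarrow> real) \<Rightarrow> real \<Rightarrow> real \<Rightarrow> real" where
  "alpha_at F A \<sigma> = (THE x. x \<in> {0<..A} \<and> deriv F x = \<sigma>)"

definition zeta_at :: "(real \<Rightarrow> real) \<Rightarrow> real \<Rightarrow> real \<Rightarrow> real \<Rightarrow> real" where
  "zeta_at F A B \<sigma> = (THE x. x \<in> {A..B} \<and> deriv F x = \<sigma>)"

definition beta_at :: "(real \<Rightarrow> real) \<Rightarrow> real \<Rightarrow> real \<Rightarrow> real" where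
  "beta_at F B \<sigma> = (THE x. x \<in> {B..} \<and> deriv F x = \<sigma>)"

definition sigma0 :: "(real \<Rightarrow> real) \<Rightarrow> real \<Rightarrow> real \<Rightarrow> real" where
  "sigma0 F A B = (THE \<sigma>. \<sigma> \<in> {deriv F B<..<deriv F A} \<and>
     Phi F \<sigma> (alpha_at F A \<sigma>) = Phi F \<sigma> (beta_at F B \<sigma>))"

definition alpha0 :: "(real \<Rightarrow> real) \<Rightarrow> real \<Rightarrow> real \<Rightarrow> real" where
  "alpha0 F A B = alpha_at F A (sigma0 F A B)"

definition beta0 :: "(real \<Rightarrow> real) \<Rightarrow> real \<Rightarrow> real \<Rightarrow> real" where
  "beta0 F A B = beta_at F B (sigma0 F A B)"

definition b0 :: "(real \<Rightarrow> real) \<Rightarrow> real \<Rightarrow> real \<Rightarrow> real" where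
  "b0 F A B = Phi F (sigma0 F A B) (alpha0 F A B)"

definition Delta0 :: "(real \<Rightarrow> real) \<Rightarrow> real \<Rightarrow> real \<Rightarrow> real \<times> real" where
  "Delta0 F A B = (sigma0 F A B, b0 F A B)"

definition admissible :: "(real \<Rightarrow> real) \<Rightarrow> real \<Rightarrow> real \<Rightarrow> real \<times> real \<Rightarrow> bool" where
  "admissible F A B = (\<lambda>(\<sigma>, b).
     \<sigma> \<in> {deriv F B<..<deriv F A} \<and>
     max (Phi F \<sigma> (alpha_at F A \<sigma>)) (Phi F \<sigma> (beta_at F B \<sigma>)) < b \<and>
     b < Phi F \<sigma> (zeta_at F A B \<sigma>))"

text \<open>
  Classical solutions of the Neumann problem with prescribed mass. Functions are
  total, so everything is relative to \<open>[-1/\<epsilon>, 1/\<epsilon>]\<close>; the boundary conditions are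
  one-sided derivatives. Continuity of \<open>z''\<close>, and of \<open>z'\<close> up to the boundary, follows
  from the equation.
\<close>

definition solution :: "(real \<Rightarrow> real) \<Rightarrow> real \<Rightarrow> real \<Rightarrow> (real \<Rightarrow> real) \<Rightarrow> real \<Rightarrow> bool" where
  "solution F \<epsilon> r z \<sigma> \<longleftrightarrow>
     (\<forall>t\<in>{-1/\<epsilon>..1/\<epsilon>}. 0 < z t) \<and>
     (\<forall>t\<in>{-1/\<epsilon><..<1/\<epsilon>}. z differentiable (at t) \<and> deriv z differentiable (at t) \<and>
        (deriv ^^ 2) Qfun (\<epsilon> * deriv z t) * (deriv ^^ 2) z t = deriv F (z t) - \<sigma>) \<and>
     (\<forall>t\<in>{-1/\<epsilon>, 1/\<epsilon>}. (z has_real_derivative 0) (at t within {-1/\<epsilon>..1/\<epsilon>})) \<and>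
     (z has_integral 2 * r / \<epsilon>) {-1/\<epsilon>..1/\<epsilon>}"

definition simple_solution ::
  "(real \<Rightarrow> real) \<Rightarrow> real \<Rightarrow> real \<Rightarrow> (real \<Rightarrow> real) \<Rightarrow> real \<Rightarrow> bool" where
  "simple_solution F \<epsilon> r z \<sigma> \<longleftrightarrow>
     solution F \<epsilon> r z \<sigma> \<and> mono_on {-1/\<epsilon>..1/\<epsilon>} z \<and> \<not> z constant_on {-1/\<epsilon>..1/\<epsilon>}"

text \<open>
  Multiplying the equation by \<open>z'\<close> and integrating gives the first integral below; it
  determines \<open>b\<close>, so a simple solution has exactly one pair \<open>(\<sigma>, b)\<close>.
\<close>

definition simple_solution_with_pair ::
  "(real \<Rightarrow> real) \<Rightarrow> real \<Rightarrow> real \<Rightarrow> real \<Rightarrow> real \<Rightarrow> (real \<Rightarrow> real) \<Rightarrow> real \<times> real \<Rightarrow> bool" where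
  "simple_solution_with_pair F A B \<epsilon> r z = (\<lambda>(\<sigma>, b).
     simple_solution F \<epsilon> r z \<sigma> \<and> admissible F A B (\<sigma>, b) \<and>
     (\<forall>t\<in>{-1/\<epsilon><..<1/\<epsilon>}. Pfun \<epsilon> (deriv z t) = Phi F \<sigma> (z t) - b))"

definition R_set :: "(real \<Rightarrow> real) \<Rightarrow> real \<Rightarrow> real \<Rightarrow> real \<Rightarrow> real set" where
  "R_set F A B \<delta> = {alpha0 F A B + \<delta>..beta0 F A B - \<delta>}"

text \<open>
  The threshold \<open>\<epsilon>\<^sub>\<delta>\<close> and the neighbourhood \<open>N\<close> of \<^const>\<open>Delta0\<close> that single out the
  Maxwell solutions: exactly one simple solution (as a function on \<open>[-1/\<epsilon>, 1/\<epsilon>]\<close>) has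
  its pair in \<open>N\<close>, and that pair is exponentially close to \<^const>\<open>Delta0\<close>, uniformly
  in \<open>r\<close>.
\<close>

definition maxwell_nbhd ::
  "(real \<Rightarrow> real) \<Rightarrow> real \<Rightarrow> real \<Rightarrow> real \<Rightarrow> real \<Rightarrow> (real \<times> real) set \<Rightarrow> bool" where
  "maxwell_nbhd F A B \<delta> \<epsilon>\<^sub>\<delta> N \<longleftrightarrow>
     0 < \<epsilon>\<^sub>\<delta> \<and> Delta0 F A B \<in> interior N \<and>
     (\<forall>\<epsilon>\<in>{0<..<\<epsilon>\<^sub>\<delta>}. \<forall>r\<in>R_set F A B \<delta>.
        (\<exists>z. \<exists>\<Delta>\<in>N. simple_solution_with_pair F A B \<epsilon> r z \<Delta>) \<and>
        (\<forall>z w. \<forall>\<Delta>\<in>N. \<forall>\<Delta>'\<in>N.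
           simple_solution_with_pair F A B \<epsilon> r z \<Delta> \<and>
           simple_solution_with_pair F A B \<epsilon> r w \<Delta>' \<longrightarrow>
           \<Delta> = \<Delta>' \<and> (\<forall>t\<in>{-1/\<epsilon>..1/\<epsilon>}. z t = w t))) \<and>
     (\<exists>C>0. \<exists>K. \<forall>\<^sub>F \<epsilon> in at_right 0. \<forall>r\<in>R_set F A B \<delta>. \<forall>z. \<forall>\<Delta>\<in>N.
        simple_solution_with_pair F A B \<epsilon> r z \<Delta> \<longrightarrow>
        dist \<Delta> (Delta0 F A B) \<le> K * exp (- C / \<epsilon>))"

definition maxwell_solution ::
  "(real \<Rightarrow> real) \<Rightarrow> real \<Rightarrow> real \<Rightarrow> (real \<times> real) set \<Rightarrow> real \<Rightarrow> real \<Rightarrow> (real \<Rightarrow> real) \<Rightarrow> bool" where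
  "maxwell_solution F A B N \<epsilon> r z \<longleftrightarrow>
     (\<exists>\<Delta>\<in>N. simple_solution_with_pair F A B \<epsilon> r z \<Delta>)"

text \<open>The values of \<^const>\<open>deriv\<close> at the two endpoints do not affect the integral.\<close>

definition energy :: "(real \<Rightarrow> real) \<Rightarrow> real \<Rightarrow> (real \<Rightarrow> real) \<Rightarrow> real" where
  "energy F \<epsilon> z =
     \<epsilon> * integral {-1/\<epsilon>..1/\<epsilon>} (\<lambda>t. Qfun (\<epsilon> * deriv z t) / \<epsilon>\<^sup>2 + F (z t))"

definition c_coeff :: "(real \<Rightarrow> real) \<Rightarrow> real \<Rightarrow> real \<Rightarrow> real \<Rightarrow> real" where
  "c_coeff F A B \<epsilon> =
     (let \<sigma>\<^sub>0 = sigma0 F A B; \<beta>\<^sub>0 = beta0 F A B; g = (\<lambda>s. F s - F \<beta>\<^sub>0 - \<sigma>\<^sub>0 * (s - \<beta>\<^sub>0))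
      in integral {alpha0 F A B..\<beta>\<^sub>0} (\<lambda>s. sqrt (g s * (2 - \<epsilon>\<^sup>2 * g s))))"

end

theory Submission
  imports Defs
begin

text \<open>
  Write \<open>G s = Phi F \<sigma> s - b\<close>. Along a solution, the first integral turns the energy density into
  \<open>\<sigma> z + b + z' sqrt (G z * (2 - \<epsilon>\<^sup>2 * G z))\<close>, so the energy equals \<open>2 (\<sigma> r + b)\<close> plus \<open>\<epsilon>\<close> times
  the integral of \<open>sqrt (G * (2 - \<epsilon>\<^sup>2 * G))\<close> over the range of \<open>z\<close>. Extended by zero, \<open>G\<close> on
  the range of \<open>z\<close> and its Maxwell counterpart on \<open>[\<alpha>\<^sub>0, \<beta>\<^sub>0]\<close> differ uniformly by at most a multiple
  of the distance between the two pairs. The inequality \<open>\<bar>sqrt x - sqrt y\<bar> \<le> sqrt \<bar>x - y\<bar>\<close>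
  then costs only a factor 2 in the exponential rate.
\<close>

section \<open>Elementary facts on square roots and one-sided derivatives\<close>

lemma abs_diff_sqrt_le:
  fixes x y :: real
  assumes "0 \<le> x" "0 \<le> y"
  shows "\<bar>sqrt x - sqrt y\<bar> \<le> sqrt \<bar>x - y\<bar>"
proof -
  have "sqrt u \<le> sqrt v + sqrt \<bar>u - v\<bar>" if "0 \<le> u" "0 \<le> v" for u v :: real
  proof -
    have "sqrt u \<le> sqrt (v + \<bar>u - v\<bar>)"
      by simp
    also have "\<dots> \<le> sqrt v + sqrt \<bar>u - v\<bar>"
      using that by (intro sqrt_add_le_add_sqrt) auto
    finally show ?thesis .
  qed
  from this [of x y] this [of y x] assms show ?thesis
    by (simp add: abs_minus_commute)
qed

lemma atLeastAtMost_cases: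
  fixes t :: real
  shows "t \<in> {a..c} \<Longrightarrow> t \<in> {a<..<c} \<or> t = a \<or> t = c"
  by auto

text \<open>Mean value theorem on a short interval ending at \<open>t0\<close>, whose secant slope
  is small because the one-sided derivative vanishes. It lets the first integral be carried to the
  boundary without first establishing continuity of \<open>deriv z\<close> there.\<close>

lemma exists_small_deriv_near_endpoint:
  fixes z :: "real \<Rightarrow> real"
  assumes "a < c" and t0: "t0 = a \<or> t0 = c"
    and der: "(z has_real_derivative 0) (at t0 within {a..c})"
    and cont: "continuous_on {a..c} z"
    and diff: "\<And>t. t \<in> {a<..<c} \<Longrightarrow> z differentiable (at t)"
    and "0 < e"
  obtains \<xi> where "\<xi> \<in> {a<..<c}" "\<bar>\<xi> - t0\<bar> < e" "\<bar>deriv z \<xi>\<bar> < e"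
proof -
  have "((\<lambda>t. (z t - z t0) / (t - t0)) \<longlongrightarrow> 0) (at t0 within {a..c})"
    using der by (simp add: has_field_derivative_iff)
  then obtain d where "d > 0"
    and d: "\<And>t. t \<in> {a..c} \<Longrightarrow> t \<noteq> t0 \<Longrightarrow> dist t t0 < d \<Longrightarrow> dist ((z t - z t0) / (t - t0)) 0 < e"
    using \<open>0 < e\<close> unfolding tendsto_iff eventually_at by metis
  \<comment> \<open>Length of the short interval: below \<open>e\<close> to keep
    \<open>\<xi>\<close> close to \<open>t0\<close>, below \<open>d\<close> to make the difference
    quotient small, below \<open>c - a\<close> to fit inside.\<close>
  define m where "m = min (min e d) (c - a) / 2"
  have m: "0 < m" "m < e" "m < d" "m < c - a"
    using \<open>d > 0\<close> \<open>0 < e\<close> \<open>a < c\<close> by (auto simp: m_def min_def field_simps)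
  define u where "u = (if t0 = a then a else c - m)"
  have u: "a \<le> u" "u + m \<le> c" "t0 = u \<or> t0 = u + m"
    using m t0 by (auto simp: u_def)
  obtain l \<xi> where \<xi>: "u < \<xi>" "\<xi> < u + m" "DERIV z \<xi> :> l" "z (u + m) - z u = (u + m - u) * l"
  proof (rule MVT [of u "u + m" z, elim_format])
    show "continuous_on {u..u + m} z"
      using u by (intro continuous_on_subset [OF cont]) auto
    show "z differentiable (at x)" if "u < x" "x < u + m" for x
      using that u by (intro diff) auto
  qed (use m in auto)
  \<comment> \<open>The end of the short interval other than \<open>t0\<close>; the slope
    \<open>l\<close> is then exactly the difference quotient at \<open>t0\<close>.\<close>
  define t where "t = (if t0 = u then u + m else u)"
  have "(z t - z t0) / (t - t0) = l"
    using u(3) \<xi>(4) m by (auto simp: t_def field_simps)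
  moreover have "t \<in> {a..c}" "t \<noteq> t0" "dist t t0 < d"
    using u m by (auto simp: t_def dist_real_def)
  ultimately have "\<bar>deriv z \<xi>\<bar> < e"
    using d [of t] DERIV_imp_deriv [OF \<xi>(3)] by (simp add: dist_real_def)
  then show thesis
    using \<xi> u m by (intro that [of \<xi>]) auto
qed

section \<open>Bounds for \<open>Pfun\<close> and its relation to \<open>Qfun\<close>\<close>

lemma Pfun_less: "0 < \<epsilon> \<Longrightarrow> \<epsilon>\<^sup>2 * Pfun \<epsilon> s < 1"
  by (simp add: Pfun_def add_pos_nonneg)

lemma Pfun_nonneg: "0 \<le> Pfun \<epsilon> s"
proof -
  have "1 \<le> sqrt (1 + \<epsilon>\<^sup>2 * s\<^sup>2)"
    by simp
  then have "1 / sqrt (1 + \<epsilon>\<^sup>2 * s\<^sup>2) \<le> 1"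
    by (auto simp only: divide_le_eq_1)
  then show ?thesis
    unfolding Pfun_def by (intro divide_nonneg_nonneg) simp_all
qed

text \<open>For \<open>w \<ge> 1\<close> one has
  \<open>1 - 1/w \<le> w - 1 \<le> w\<^sup>2 - 1\<close>. The resulting bound is uniform in
  \<epsilon> and makes \<open>Pfun\<close> small whenever the slope is.\<close>

lemma Pfun_le_square:
  assumes "0 < \<epsilon>"
  shows "Pfun \<epsilon> s \<le> s\<^sup>2"
proof -
  define w where "w = sqrt (1 + \<epsilon>\<^sup>2 * s\<^sup>2)"
  have w: "w \<ge> 1" "w\<^sup>2 = 1 + \<epsilon>\<^sup>2 * s\<^sup>2"
    by (auto simp: w_def)
  have "1 - 1 / w = (w - 1) / w"
    using w by (simp add: field_simps)
  also have "\<dots> \<le> (w - 1) / 1"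
    using w by (intro divide_left_mono) auto
  also have "\<dots> \<le> (w - 1) * (w + 1)"
    using w mult_left_mono [of 1 "w + 1" "w - 1"] by simp
  also have "\<dots> = \<epsilon>\<^sup>2 * s\<^sup>2"
    using w(2) by (simp add: algebra_simps power2_eq_square)
  finally show ?thesis
    using assms by (simp add: Pfun_def w_def [symmetric] divide_le_eq mult.commute)
qed

text \<open>In terms of \<open>w\<close>, the radicand is \<open>(s / w)\<^sup>2\<close>, and the
  claim reduces to \<open>(w - 1) / \<epsilon>\<^sup>2 = s\<^sup>2 / w - Pfun \<epsilon> s\<close>.
  The factor \<open>s\<close> in front of the root is what later permits the substitution by the
  values of the solution.\<close>

lemma Qfun_eq_Pfun:
  assumes "0 < \<epsilon>" "0 \<le> s"
  shows "Qfun (\<epsilon> * s) / \<epsilon>\<^sup>2 = s * sqrt (Pfun \<epsilon> s * (2 - \<epsilon>\<^sup>2 * Pfun \<epsilon> s)) - Pfun \<epsilon> s"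
proof -
  define w where "w = sqrt (1 + \<epsilon>\<^sup>2 * s\<^sup>2)"
  have w: "w \<ge> 1" "w\<^sup>2 = 1 + \<epsilon>\<^sup>2 * s\<^sup>2"
    by (auto simp: w_def)
  have P: "Pfun \<epsilon> s = (1 - 1 / w) / \<epsilon>\<^sup>2"
    by (simp add: Pfun_def w_def)
  have "Pfun \<epsilon> s * (2 - \<epsilon>\<^sup>2 * Pfun \<epsilon> s) = (w\<^sup>2 - 1) / (w\<^sup>2 * \<epsilon>\<^sup>2)"
    using w(1) \<open>0 < \<epsilon>\<close> by (simp add: P field_simps power2_eq_square)
  also have "\<dots> = (s / w)\<^sup>2"
    using w(1) \<open>0 < \<epsilon>\<close> by (simp add: w(2) power_divide)
  finally have "sqrt (Pfun \<epsilon> s * (2 - \<epsilon>\<^sup>2 * Pfun \<epsilon> s)) = s / w"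
    using w(1) \<open>0 \<le> s\<close> by (metis abs_of_nonneg divide_nonneg_nonneg order_trans real_sqrt_abs zero_le_one)
  moreover have "s * (s / w) = (w\<^sup>2 - 1) / (w * \<epsilon>\<^sup>2)"
    using w(1) \<open>0 < \<epsilon>\<close> unfolding w(2) by (simp add: field_simps power2_eq_square)
  moreover have "Qfun (\<epsilon> * s) = w - 1"
    by (simp add: Qfun_def w_def power_mult_distrib)
  moreover have "(w - 1) / \<epsilon>\<^sup>2 = (w\<^sup>2 - 1) / (w * \<epsilon>\<^sup>2) - Pfun \<epsilon> s"
    using w(1) \<open>0 < \<epsilon>\<close> by (simp add: P field_simps power2_eq_square)
  ultimately show ?thesis by simp
qed

section \<open>Critical points and monotonicity of the tilted potential\<close>

locale double_well_potential =
  fixes F :: "real \<Rightarrow> real" and A B :: real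
  assumes double_well: "double_well F A B"
begin

abbreviation "\<alpha> \<equiv> alpha_at F A"
abbreviation "\<zeta> \<equiv> zeta_at F A B"
abbreviation "\<beta> \<equiv> beta_at F B"
abbreviation "\<Phi> \<equiv> Phi F"
abbreviation "F' \<equiv> deriv F"
abbreviation "S \<equiv> {F' B..F' A}"

lemma A_pos: "0 < A" and A_less_B: "A < B"
  using double_well by (auto simp: double_well_def)

lemma DERIV_F: "x > 0 \<Longrightarrow> (F has_real_derivative F' x) (at x)"
  using double_well unfolding double_well_def
  by (metis DERIV_deriv_iff_real_differentiable funpow_0 zero_less_numeral)

lemma DERIV_F': "x > 0 \<Longrightarrow> (F' has_real_derivative (deriv ^^ 2) F x) (at x)"
proof -
  assume "x > 0"
  moreover have "(1::nat) < 5" by simp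
  ultimately have "(deriv ^^ 1) F differentiable (at x)"
    using double_well unfolding double_well_def by blast
  then show ?thesis
    by (simp add: DERIV_deriv_iff_real_differentiable numeral_2_eq_2)
qed

lemma continuous_on_F: "T \<subseteq> {0<..} \<Longrightarrow> continuous_on T F"
  by (meson DERIV_F DERIV_isCont continuous_at_imp_continuous_on greaterThan_iff subsetD)

lemma continuous_on_F': "T \<subseteq> {0<..} \<Longrightarrow> continuous_on T F'"
  by (meson DERIV_F' DERIV_isCont continuous_at_imp_continuous_on greaterThan_iff subsetD)

lemma continuous_on_Phi: "T \<subseteq> {0<..} \<Longrightarrow> continuous_on T (\<Phi> \<sigma>)"
  unfolding Phi_def [abs_def] by (intro continuous_intros continuous_on_F)

lemma F'_less_left: "F' x < F' y" if "0 < x" "x < y" "y \<le> A"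
proof (rule DERIV_pos_imp_increasing_open [OF \<open>x < y\<close>])
  fix u assume "x < u" "u < y"
  then show "\<exists>d. (F' has_real_derivative d) (at u) \<and> 0 < d"
    using that double_well A_pos A_less_B
    by (intro exI [of _ "(deriv ^^ 2) F u"] conjI DERIV_F') (auto simp: double_well_def)
qed (use that in \<open>auto intro!: continuous_on_F'\<close>)

lemma F'_less_mid: "F' y < F' x" if "A \<le> x" "x < y" "y \<le> B"
proof (rule DERIV_neg_imp_decreasing_open [OF \<open>x < y\<close>])
  fix u assume "x < u" "u < y"
  then show "\<exists>d. (F' has_real_derivative d) (at u) \<and> d < 0"
    using that double_well A_pos A_less_B
    by (intro exI [of _ "(deriv ^^ 2) F u"] conjI DERIV_F') (auto simp: double_well_def)
qed (use that A_pos in \<open>auto intro!: continuous_on_F'\<close>)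

lemma F'_less_right: "F' x < F' y" if "B \<le> x" "x < y"
proof (rule DERIV_pos_imp_increasing_open [OF \<open>x < y\<close>])
  fix u assume "x < u" "u < y"
  then show "\<exists>d. (F' has_real_derivative d) (at u) \<and> 0 < d"
    using that double_well A_pos A_less_B
    by (intro exI [of _ "(deriv ^^ 2) F u"] conjI DERIV_F') (auto simp: double_well_def)
qed (use that A_pos A_less_B in \<open>auto intro!: continuous_on_F'\<close>)

lemma F'_B_less_A: "F' B < F' A"
  using F'_less_mid A_less_B by blast

text \<open>Existence by the intermediate value theorem, the limit of \<open>F'\<close> at 0
  supplying a point with \<open>F' y < F' B\<close>; uniqueness by strict monotonicity. The
  endpoints of \<open>S\<close> are included so that \<open>gap\<close> can be evaluated there. The
  limit at infinity serves \<open>beta_at\<close> in the same way.\<close>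

lemma alpha_at:
  assumes "\<sigma> \<in> S"
  shows "0 < \<alpha> \<sigma>" "\<alpha> \<sigma> \<le> A" "F' (\<alpha> \<sigma>) = \<sigma>"
proof -
  obtain l where l: "((\<lambda>x. ereal (F' x)) \<longlongrightarrow> l) (at_right 0)" "l < ereal (F' B)"
    using double_well by (auto simp: double_well_def)
  then have "\<forall>\<^sub>F x in at_right 0. ereal (F' x) < ereal (F' B)"
    by (rule order_tendstoD)
  moreover have "\<forall>\<^sub>F x in at_right (0::real). 0 < x \<and> x < A"
    using A_pos by (auto simp: eventually_at_right_field)
  ultimately obtain y where y: "0 < y" "y < A" "F' y < F' B"
    using eventually_happens [OF eventually_conj] by force
  then obtain x where "y \<le> x" "x \<le> A" "F' x = \<sigma>"
    using IVT' [of F' y \<sigma> A] assms by (force intro: continuous_on_F')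
  with y(1) have x: "x \<in> {0<..A} \<and> F' x = \<sigma>"
    by simp
  then have "\<exists>!x. x \<in> {0<..A} \<and> F' x = \<sigma>"
    using F'_less_left
    by (intro ex1I [of _ x] x) (metis greaterThanAtMost_iff less_irrefl linorder_neqE)
  from theI' [OF this] show "0 < \<alpha> \<sigma>" "\<alpha> \<sigma> \<le> A" "F' (\<alpha> \<sigma>) = \<sigma>"
    unfolding alpha_at_def by auto
qed

lemma zeta_at:
  assumes "\<sigma> \<in> S"
  shows "A \<le> \<zeta> \<sigma>" "\<zeta> \<sigma> \<le> B" "F' (\<zeta> \<sigma>) = \<sigma>"
proof -
  obtain x where "A \<le> x" "x \<le> B" "F' x = \<sigma>"
    using IVT2' [of F' B \<sigma> A] assms A_pos A_less_B by (force intro: continuous_on_F')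
  then have "\<exists>!x. x \<in> {A..B} \<and> F' x = \<sigma>"
    using F'_less_mid by (intro ex1I [of _ x]) (auto, metis less_irrefl linorder_neqE)
  from theI' [OF this] show "A \<le> \<zeta> \<sigma>" "\<zeta> \<sigma> \<le> B" "F' (\<zeta> \<sigma>) = \<sigma>"
    unfolding zeta_at_def by auto
qed

lemma beta_at:
  assumes "\<sigma> \<in> S"
  shows "B \<le> \<beta> \<sigma>" "F' (\<beta> \<sigma>) = \<sigma>"
proof -
  obtain l where l: "((\<lambda>x. ereal (F' x)) \<longlongrightarrow> l) at_top" "l > ereal (F' A)"
    using double_well by (auto simp: double_well_def)
  then have "\<forall>\<^sub>F x in at_top. ereal (F' x) > ereal (F' A)"
    by (rule order_tendstoD)
  then obtain y where y: "B < y" "F' y > F' A"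
    using eventually_happens [OF eventually_conj [OF _ eventually_gt_at_top [of B]]] by force
  then obtain x where "B \<le> x" "x \<le> y" "F' x = \<sigma>"
    using IVT' [of F' B \<sigma> y] assms A_pos A_less_B by (force intro: continuous_on_F')
  then have "\<exists>!x. x \<in> {B..} \<and> F' x = \<sigma>"
    using F'_less_right by (intro ex1I [of _ x]) (auto, metis less_irrefl linorder_neqE)
  from theI' [OF this] show "B \<le> \<beta> \<sigma>" "F' (\<beta> \<sigma>) = \<sigma>"
    unfolding beta_at_def by auto
qed

lemma DERIV_Phi: "x > 0 \<Longrightarrow> (\<Phi> \<sigma> has_real_derivative F' x - \<sigma>) (at x)"
  unfolding Phi_def [abs_def] by (auto intro!: derivative_eq_intros DERIV_F)

lemma Phi_increasing:
  assumes "0 < x" "x < y" "\<And>u. x < u \<Longrightarrow> u < y \<Longrightarrow> \<sigma> < F' u"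
  shows "\<Phi> \<sigma> x < \<Phi> \<sigma> y"
proof (rule DERIV_pos_imp_increasing_open [OF \<open>x < y\<close>])
  fix u assume "x < u" "u < y"
  then show "\<exists>d. (\<Phi> \<sigma> has_real_derivative d) (at u) \<and> 0 < d"
    using assms by (intro exI [of _ "F' u - \<sigma>"] conjI DERIV_Phi) auto
qed (use assms in \<open>auto intro!: continuous_on_Phi\<close>)

lemma Phi_decreasing:
  assumes "0 < x" "x < y" "\<And>u. x < u \<Longrightarrow> u < y \<Longrightarrow> F' u < \<sigma>"
  shows "\<Phi> \<sigma> y < \<Phi> \<sigma> x"
proof (rule DERIV_neg_imp_decreasing_open [OF \<open>x < y\<close>])
  fix u assume "x < u" "u < y"
  then show "\<exists>d. (\<Phi> \<sigma> has_real_derivative d) (at u) \<and> d < 0"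
    using assms by (intro exI [of _ "F' u - \<sigma>"] conjI DERIV_Phi) auto
qed (use assms in \<open>auto intro!: continuous_on_Phi\<close>)

context
  fixes \<sigma> assumes \<sigma>: "\<sigma> \<in> S"
begin

lemma Phi_less_left: "0 < x \<Longrightarrow> x < y \<Longrightarrow> y \<le> \<alpha> \<sigma> \<Longrightarrow> \<Phi> \<sigma> y < \<Phi> \<sigma> x"
  using F'_less_left [of _ "\<alpha> \<sigma>"] alpha_at [OF \<sigma>]
  by (intro Phi_decreasing) fastforce+

text \<open>\<open>F'\<close> rises up to \<open>A\<close> and falls after it, so on either side of
  \<open>A\<close> it stays above the value \<sigma> that it takes at
  \<open>\<alpha> \<sigma>\<close> and \<open>\<zeta> \<sigma>\<close>.\<close>

lemma Phi_less_mid_left: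
  assumes "\<alpha> \<sigma> \<le> x" "x < y" "y \<le> \<zeta> \<sigma>"
  shows "\<Phi> \<sigma> x < \<Phi> \<sigma> y"
proof (rule Phi_increasing)
  fix u assume "x < u" "u < y"
  then show "\<sigma> < F' u"
    using F'_less_left [of "\<alpha> \<sigma>" u] F'_less_mid [of u "\<zeta> \<sigma>"] alpha_at [OF \<sigma>] zeta_at [OF \<sigma>] assms
    by (cases "u \<le> A") auto
qed (use assms alpha_at [OF \<sigma>] in auto)

lemma Phi_less_mid_right:
  assumes "\<zeta> \<sigma> \<le> x" "x < y" "y \<le> \<beta> \<sigma>"
  shows "\<Phi> \<sigma> y < \<Phi> \<sigma> x"
proof (rule Phi_decreasing)
  fix u assume "x < u" "u < y"
  then show "F' u < \<sigma>"
    using F'_less_right [of u "\<beta> \<sigma>"] F'_less_mid [of "\<zeta> \<sigma>" u] beta_at [OF \<sigma>] zeta_at [OF \<sigma>] assms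
    by (cases "u \<le> B") auto
qed (use assms zeta_at [OF \<sigma>] A_pos in auto)

lemma Phi_less_right: "\<beta> \<sigma> \<le> x \<Longrightarrow> x < y \<Longrightarrow> \<Phi> \<sigma> x < \<Phi> \<sigma> y"
  using F'_less_right [of "\<beta> \<sigma>"] beta_at [OF \<sigma>] A_pos A_less_B
  by (intro Phi_increasing) fastforce+

lemma Phi_alpha_le: "0 < x \<Longrightarrow> x \<le> \<zeta> \<sigma> \<Longrightarrow> \<Phi> \<sigma> (\<alpha> \<sigma>) \<le> \<Phi> \<sigma> x"
  using Phi_less_left [of x "\<alpha> \<sigma>"] Phi_less_mid_left [of "\<alpha> \<sigma>" x]
  by (cases x "\<alpha> \<sigma>" rule: linorder_cases) auto

lemma Phi_beta_le: "\<zeta> \<sigma> \<le> x \<Longrightarrow> \<Phi> \<sigma> (\<beta> \<sigma>) \<le> \<Phi> \<sigma> x"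
  using Phi_less_right [of "\<beta> \<sigma>" x] Phi_less_mid_right [of x "\<beta> \<sigma>"]
  by (cases x "\<beta> \<sigma>" rule: linorder_cases) auto

end

section \<open>Existence and uniqueness of the Maxwell point\<close>

definition gap :: "real \<Rightarrow> real" where
  "gap \<sigma> = \<Phi> \<sigma> (\<alpha> \<sigma>) - \<Phi> \<sigma> (\<beta> \<sigma>)"

text \<open>Envelope argument: compare the minimum of \<open>\<Phi> \<tau>\<close> at
  \<open>\<alpha> \<tau>\<close> with the competitor \<open>\<alpha> \<sigma>\<close>, and that of
  \<open>\<Phi> \<sigma>\<close> at \<open>\<beta> \<sigma>\<close> with
  \<open>\<beta> \<tau>\<close>. Used in both orders of the parameters, it yields monotonicity and
  Lipschitz continuity without differentiating the critical points in \<sigma>.\<close>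

lemma gap_bounds:
  assumes "\<sigma> \<in> S" "\<tau> \<in> S"
  shows "gap \<tau> \<le> gap \<sigma> + (\<tau> - \<sigma>) * (\<beta> \<tau> - \<alpha> \<sigma>)"
proof -
  have "\<Phi> \<tau> (\<alpha> \<tau>) \<le> \<Phi> \<tau> (\<alpha> \<sigma>)" "\<Phi> \<sigma> (\<beta> \<sigma>) \<le> \<Phi> \<sigma> (\<beta> \<tau>)"
    using assms alpha_at [of \<sigma>] zeta_at [of \<tau>] zeta_at [of \<sigma>] beta_at [of \<tau>]
    by (intro Phi_alpha_le Phi_beta_le; simp)+
  then show ?thesis
    by (simp add: gap_def Phi_def algebra_simps)
qed

lemma gap_less:
  assumes "\<sigma> \<in> S" "\<tau> \<in> S" "\<sigma> < \<tau>"
  shows "gap \<sigma> < gap \<tau>"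
proof -
  \<comment> \<open>The parameters are exchanged here; the extra term is negative because
    \<open>\<alpha> \<tau> \<le> A < B \<le> \<beta> \<sigma>\<close>.\<close>
  have "gap \<sigma> \<le> gap \<tau> + (\<sigma> - \<tau>) * (\<beta> \<sigma> - \<alpha> \<tau>)"
    using assms by (intro gap_bounds)
  moreover have "(\<sigma> - \<tau>) * (\<beta> \<sigma> - \<alpha> \<tau>) < 0"
    using assms A_less_B alpha_at [of \<tau>] beta_at [of \<sigma>] by (intro mult_neg_pos) auto
  ultimately show ?thesis by linarith
qed

lemma beta_le_max:
  assumes "\<sigma> \<in> S"
  shows "\<beta> \<sigma> \<le> \<beta> (F' A)"
  using F'_less_right [of "\<beta> (F' A)" "\<beta> \<sigma>"] beta_at [OF assms] beta_at [of "F' A"] assms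
  by (cases "\<beta> \<sigma> \<le> \<beta> (F' A)") auto

text \<open>The largest value \<open>\<beta> (F' A)\<close> of \<beta> is a Lipschitz constant:
  \<open>gap_bounds\<close> limits the increase and \<open>gap_less\<close> excludes a
  decrease.\<close>

lemma continuous_on_gap: "continuous_on S gap"
proof (rule lipschitz_on_continuous_on)
  have lip: "dist (gap \<sigma>) (gap \<tau>) \<le> \<beta> (F' A) * dist \<sigma> \<tau>" if *: "\<sigma> \<in> S" "\<tau> \<in> S" "\<sigma> < \<tau>" for \<sigma> \<tau>
  proof -
    have "gap \<tau> \<le> gap \<sigma> + (\<tau> - \<sigma>) * (\<beta> \<tau> - \<alpha> \<sigma>)"
      using * by (intro gap_bounds)
    also have "\<dots> \<le> gap \<sigma> + (\<tau> - \<sigma>) * \<beta> (F' A)"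
      using * beta_le_max [of \<tau>] alpha_at [of \<sigma>] by (intro add_left_mono mult_left_mono) auto
    finally show ?thesis
      using gap_less [OF *] * by (simp add: dist_real_def algebra_simps)
  qed
  show "(\<beta> (F' A))-lipschitz_on S gap"
  proof (rule lipschitz_onI)
    show "dist (gap \<sigma>) (gap \<tau>) \<le> \<beta> (F' A) * dist \<sigma> \<tau>" if "\<sigma> \<in> S" "\<tau> \<in> S" for \<sigma> \<tau>
      using that lip [of \<sigma> \<tau>] lip [of \<tau> \<sigma>]
      by (cases \<sigma> \<tau> rule: linorder_cases) (auto simp: dist_commute)
    show "0 \<le> \<beta> (F' A)"
      using beta_at(1) [of "F' A"] F'_B_less_A A_pos A_less_B by auto
  qed
qed

text \<open>At each end of \<open>S\<close> two of the three critical points merge and one well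
  disappears, so the sign of \<open>gap\<close> can be read off there.\<close>

lemma zeta_B: "\<zeta> (F' B) = B"
  using F'_less_mid [of "\<zeta> (F' B)" B] zeta_at [of "F' B"] F'_B_less_A by fastforce

lemma zeta_A: "\<zeta> (F' A) = A"
  using F'_less_mid [of A "\<zeta> (F' A)"] zeta_at [of "F' A"] F'_B_less_A by fastforce

lemma beta_B: "\<beta> (F' B) = B"
  using F'_less_right [of B "\<beta> (F' B)"] beta_at [of "F' B"] F'_B_less_A by fastforce

lemma alpha_A: "\<alpha> (F' A) = A"
  using F'_less_left [of "\<alpha> (F' A)" A] alpha_at [of "F' A"] F'_B_less_A by fastforce

abbreviation "\<sigma>0 \<equiv> sigma0 F A B"
abbreviation "\<alpha>0 \<equiv> alpha0 F A B"
abbreviation "\<beta>0 \<equiv> beta0 F A B"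

text \<open>\<open>gap\<close> is continuous and strictly increasing, negative at
  \<open>F' B\<close> and positive at \<open>F' A\<close>; its single zero is therefore
  interior.\<close>

lemma sigma0: "\<sigma>0 \<in> {F' B<..<F' A}" "\<Phi> \<sigma>0 \<alpha>0 = \<Phi> \<sigma>0 \<beta>0"
proof -
  have B: "F' B \<in> S" and A: "F' A \<in> S"
    using F'_B_less_A by auto
  have neg: "gap (F' B) < 0"
    using Phi_less_mid_left [OF B, of "\<alpha> (F' B)" B] alpha_at [OF B] A_less_B zeta_B beta_B
    by (simp add: gap_def)
  have pos: "gap (F' A) > 0"
    using Phi_less_mid_right [OF A, of A "\<beta> (F' A)"] beta_at [OF A] A_less_B zeta_A alpha_A
    by (simp add: gap_def)
  obtain \<sigma> where \<sigma>: "F' B \<le> \<sigma>" "\<sigma> \<le> F' A" "gap \<sigma> = 0"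
    using IVT' [of gap "F' B" 0 "F' A"] continuous_on_gap neg pos F'_B_less_A by force
  then have "\<sigma> \<noteq> F' A" "\<sigma> \<noteq> F' B"
    using neg pos by auto
  have "\<exists>!\<sigma>. \<sigma> \<in> {F' B<..<F' A} \<and> \<Phi> \<sigma> (\<alpha> \<sigma>) = \<Phi> \<sigma> (\<beta> \<sigma>)"
  proof (rule ex1I)
    show "\<sigma> \<in> {F' B<..<F' A} \<and> \<Phi> \<sigma> (\<alpha> \<sigma>) = \<Phi> \<sigma> (\<beta> \<sigma>)"
      using \<sigma> \<open>\<sigma> \<noteq> F' A\<close> \<open>\<sigma> \<noteq> F' B\<close> by (auto simp: gap_def)
    show "\<tau> = \<sigma>" if "\<tau> \<in> {F' B<..<F' A} \<and> \<Phi> \<tau> (\<alpha> \<tau>) = \<Phi> \<tau> (\<beta> \<tau>)" for \<tau>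
      using that \<sigma> gap_less [of \<sigma> \<tau>] gap_less [of \<tau> \<sigma>]
      by (cases \<sigma> \<tau> rule: linorder_cases) (auto simp: gap_def)
  qed
  from theI' [OF this] show "\<sigma>0 \<in> {F' B<..<F' A}" "\<Phi> \<sigma>0 \<alpha>0 = \<Phi> \<sigma>0 \<beta>0"
    by (auto simp: sigma0_def alpha0_def beta0_def)
qed

section \<open>Zero-extended profiles and comparison of transition costs\<close>

text \<open>The range of a simple solution with pair \<open>(\<sigma>, b)\<close>, as well as \<open>[\<alpha>\<^sub>0, \<beta>\<^sub>0]\<close> for the Maxwell point.\<close>

definition hump :: "real \<Rightarrow> real \<Rightarrow> real \<Rightarrow> real \<Rightarrow> bool" where
  "hump \<sigma> b a c \<longleftrightarrow> \<sigma> \<in> S \<and> \<alpha> \<sigma> \<le> a \<and> a \<le> \<zeta> \<sigma> \<and> \<zeta> \<sigma> \<le> c \<and> c \<le> \<beta> \<sigma> \<and>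
     \<Phi> \<sigma> a = b \<and> \<Phi> \<sigma> c = b"

text \<open>The Maxwell pair is not admissible, since its level equals both well depths. The weak
  inequalities in \<open>hump\<close> accommodate this limiting case.\<close>

lemma hump_Maxwell: "hump \<sigma>0 (b0 F A B) \<alpha>0 \<beta>0"
proof -
  have "\<sigma>0 \<in> S" using sigma0 by auto
  then show ?thesis
    using sigma0 alpha_at(2) [of \<sigma>0] zeta_at [of \<sigma>0] beta_at [of \<sigma>0]
    unfolding hump_def b0_def unfolding alpha0_def beta0_def by auto
qed

lemma hump_nonneg:
  assumes "hump \<sigma> b a c" "x \<in> {a..c}"
  shows "0 \<le> \<Phi> \<sigma> x - b"
proof (cases "x \<le> \<zeta> \<sigma>")
  case True
  then show ?thesis
    using Phi_less_mid_left [of \<sigma> a x] assms by (cases "x = a") (auto simp: hump_def)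
next
  case False
  then show ?thesis
    using Phi_less_mid_right [of \<sigma> x c] assms by (cases "x = c") (auto simp: hump_def)
qed

text \<open>This is not the positive part of \<open>\<Phi> \<sigma> s - b\<close>, which may become
  positive again to the left of \<open>\<alpha> \<sigma>\<close> or to the right of
  \<open>\<beta> \<sigma>\<close>.\<close>

definition profile :: "real \<Rightarrow> real \<Rightarrow> real \<Rightarrow> real \<Rightarrow> real \<Rightarrow> real" where
  "profile \<sigma> b a c s = (if s \<in> {a..c} then \<Phi> \<sigma> s - b else 0)"

lemma profile_nonneg: "hump \<sigma> b a c \<Longrightarrow> 0 \<le> profile \<sigma> b a c s"
  using hump_nonneg by (simp add: profile_def)

text \<open>The critical case is \<open>s\<close> in \<open>{a..c}\<close> but outside
  \<open>{a'..c'}\<close>. Between \<open>{a'..c'}\<close> and the wells of \<tau>,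
  \<open>\<Phi> \<tau> s\<close> is below \<open>d\<close> and closeness at \<open>s\<close>
  suffices. Beyond a well of \<tau> that fails; there the monotonicity of
  \<open>\<Phi> \<sigma>\<close> moves \<open>s\<close> to that well, where
  \<open>\<Phi> \<sigma>\<close> is larger and \<open>\<Phi> \<tau>\<close> is at most
  \<open>d\<close>.\<close>

lemma profile_le:
  assumes 1: "hump \<sigma> b a c" and 2: "hump \<tau> d a' c'"
    and M: "c \<le> M"
    and \<eta>: "\<And>s. s \<in> {0<..M} \<Longrightarrow> \<Phi> \<sigma> s - b \<le> \<Phi> \<tau> s - d + \<eta>"
    and "0 \<le> \<eta>"
  shows "profile \<sigma> b a c s \<le> profile \<tau> d a' c' s + \<eta>"
proof (cases "s \<in> {a..c}")
  case False
  then show ?thesis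
    using profile_nonneg [OF 2, of s] \<open>0 \<le> \<eta>\<close> by (auto simp: profile_def)
next
  case s: True
  have \<sigma>: "\<sigma> \<in> S" and \<tau>: "\<tau> \<in> S"
    using 1 2 by (auto simp: hump_def)
  note crit = alpha_at [OF \<sigma>] alpha_at [OF \<tau>] beta_at [OF \<sigma>] beta_at [OF \<tau>]
    zeta_at [OF \<sigma>] zeta_at [OF \<tau>]
  have sM: "s \<in> {0<..M}"
    using s M 1 crit by (auto simp: hump_def)
  have *: "\<Phi> \<sigma> s - b \<le> \<eta>" if "s \<notin> {a'..c'}"
  proof (cases "s < a'")
    case True
    show ?thesis
    proof (cases "\<alpha> \<tau> \<le> s")
      case le: True
      then have "\<Phi> \<tau> s < \<Phi> \<tau> a'"
        using True 2 by (intro Phi_less_mid_left) (auto simp: hump_def)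
      then show ?thesis
        using \<eta> [OF sM] 2 by (auto simp: hump_def)
    next
      case False
      have "\<Phi> \<sigma> s < \<Phi> \<sigma> (\<alpha> \<tau>)"
        using False s 1 crit by (intro Phi_less_mid_left) (auto simp: hump_def)
      moreover have "\<alpha> \<tau> \<le> M"
        using crit 1 M by (auto simp: hump_def)
      moreover have "\<Phi> \<tau> (\<alpha> \<tau>) \<le> \<Phi> \<tau> a'"
        using 2 crit by (intro Phi_alpha_le) (auto simp: hump_def)
      ultimately show ?thesis
        using \<eta> [of "\<alpha> \<tau>"] 2 crit by (auto simp: hump_def)
    qed
  next
    case False
    then have "c' < s" using that by auto
    show ?thesis
    proof (cases "s \<le> \<beta> \<tau>")
      case True
      then have "\<Phi> \<tau> s < \<Phi> \<tau> c'"
        using \<open>c' < s\<close> 2 by (intro Phi_less_mid_right) (auto simp: hump_def)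
      then show ?thesis
        using \<eta> [OF sM] 2 by (auto simp: hump_def)
    next
      case False
      have "\<Phi> \<sigma> s < \<Phi> \<sigma> (\<beta> \<tau>)"
        using False s 1 crit by (intro Phi_less_mid_right) (auto simp: hump_def)
      moreover have "\<beta> \<tau> \<in> {0<..M}"
        using False sM crit A_pos A_less_B by auto
      moreover have "\<Phi> \<tau> (\<beta> \<tau>) \<le> \<Phi> \<tau> c'"
        using 2 by (intro Phi_beta_le) (auto simp: hump_def)
      ultimately show ?thesis
        using \<eta> [of "\<beta> \<tau>"] 2 by (auto simp: hump_def)
    qed
  qed
  show ?thesis
    using * \<eta> [OF sM] s by (auto simp: profile_def)
qed

lemma hump_pos: "hump \<sigma> b a c \<Longrightarrow> 0 < a"
  using alpha_at(1) [of \<sigma>] by (auto simp: hump_def)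

lemma abs_profile_diff_le:
  assumes "hump \<sigma> b a c" "hump \<tau> d a' c'" "c \<le> M" "c' \<le> M"
    and "\<And>s. s \<in> {0<..M} \<Longrightarrow> \<bar>(\<Phi> \<sigma> s - b) - (\<Phi> \<tau> s - d)\<bar> \<le> \<eta>"
    and "0 \<le> \<eta>"
  shows "\<bar>profile \<sigma> b a c s - profile \<tau> d a' c' s\<bar> \<le> \<eta>"
  using profile_le [of \<sigma> b a c \<tau> d a' c' M \<eta> s] profile_le [of \<tau> d a' c' \<sigma> b a c M \<eta> s] assms
  by (fastforce simp: abs_le_iff)

text \<open>Cost of one transition layer; for the Maxwell pair it is the coefficient
  \<open>c_coeff\<close>.\<close>

definition transition_cost :: "real \<Rightarrow> real \<Rightarrow> real \<Rightarrow> real \<Rightarrow> real \<Rightarrow> real" where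
  "transition_cost \<epsilon> \<sigma> b a c =
     integral {a..c} (\<lambda>s. sqrt ((\<Phi> \<sigma> s - b) * (2 - \<epsilon>\<^sup>2 * (\<Phi> \<sigma> s - b))))"

text \<open>The integrand vanishes wherever the profile does, so costs of different pairs become
  integrals over one common interval and can be subtracted pointwise.\<close>

lemma transition_cost_profile:
  assumes "hump \<sigma> b a c" "c \<le> M"
  shows "((\<lambda>s. sqrt (profile \<sigma> b a c s * (2 - \<epsilon>\<^sup>2 * profile \<sigma> b a c s)))
           has_integral transition_cost \<epsilon> \<sigma> b a c) {0..M}"
proof -
  let ?f = "\<lambda>s. sqrt ((\<Phi> \<sigma> s - b) * (2 - \<epsilon>\<^sup>2 * (\<Phi> \<sigma> s - b)))"
  have a: "0 < a" using assms hump_pos by blast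
  then have "continuous_on {a..c} ?f"
    by (intro continuous_intros continuous_on_Phi) auto
  then have "(?f has_integral transition_cost \<epsilon> \<sigma> b a c) {a..c}"
    unfolding transition_cost_def by (intro integrable_integral integrable_continuous_interval)
  moreover have "{a..c} \<subseteq> {0..M}"
    using a assms by auto
  ultimately have "((\<lambda>s. if s \<in> {a..c} then ?f s else 0) has_integral transition_cost \<epsilon> \<sigma> b a c) {0..M}"
    by (simp only: has_integral_restrict)
  then show ?thesis
    by (rule has_integral_eq [rotated]) (simp add: profile_def)
qed

text \<open>The radicands differ by \<open>(p - q) * (2 - \<epsilon>\<^sup>2 * p -
  \<epsilon>\<^sup>2 * q)\<close>, where the second factor is at most 2 in modulus because
  \<open>\<epsilon>\<^sup>2 * p\<close> and \<open>\<epsilon>\<^sup>2 * q\<close> lie in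
  [0, 1].\<close>

lemma abs_transition_cost_diff_le:
  assumes 1: "hump \<sigma> b a c" and 2: "hump \<tau> d a' c'" and M: "c \<le> M" "c' \<le> M"
    and \<eta>: "\<And>s. s \<in> {0<..M} \<Longrightarrow> \<bar>(\<Phi> \<sigma> s - b) - (\<Phi> \<tau> s - d)\<bar> \<le> \<eta>"
    and "0 \<le> \<eta>"
    and \<epsilon>1: "\<And>s. s \<in> {a..c} \<Longrightarrow> \<epsilon>\<^sup>2 * (\<Phi> \<sigma> s - b) \<le> 1"
    and \<epsilon>2: "\<And>s. s \<in> {a'..c'} \<Longrightarrow> \<epsilon>\<^sup>2 * (\<Phi> \<tau> s - d) \<le> 1"
    and "0 \<le> M"
  shows "\<bar>transition_cost \<epsilon> \<sigma> b a c - transition_cost \<epsilon> \<tau> d a' c'\<bar> \<le> M * sqrt (2 * \<eta>)"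
proof -
  let ?p = "profile \<sigma> b a c" and ?q = "profile \<tau> d a' c'"
  have bound: "\<bar>sqrt (?p s * (2 - \<epsilon>\<^sup>2 * ?p s)) - sqrt (?q s * (2 - \<epsilon>\<^sup>2 * ?q s))\<bar> \<le> sqrt (2 * \<eta>)" for s
  proof -
    define p q where "p = ?p s" and "q = ?q s"
    have p: "0 \<le> p" "\<epsilon>\<^sup>2 * p \<le> 1" and q: "0 \<le> q" "\<epsilon>\<^sup>2 * q \<le> 1"
      using profile_nonneg [OF 1] profile_nonneg [OF 2] \<epsilon>1 \<epsilon>2 by (auto simp: p_def q_def profile_def)
    have "0 \<le> \<epsilon>\<^sup>2 * p" "0 \<le> \<epsilon>\<^sup>2 * q"
      using p q by simp_all
    then have "\<bar>2 - \<epsilon>\<^sup>2 * p - \<epsilon>\<^sup>2 * q\<bar> \<le> 2"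
      using p q by linarith
    moreover have "\<bar>p - q\<bar> \<le> \<eta>"
      unfolding p_def q_def by (intro abs_profile_diff_le [OF 1 2 M] \<eta> \<open>0 \<le> \<eta>\<close>)
    ultimately have "\<bar>p - q\<bar> * \<bar>2 - \<epsilon>\<^sup>2 * p - \<epsilon>\<^sup>2 * q\<bar> \<le> \<eta> * 2"
      using \<open>0 \<le> \<eta>\<close> by (intro mult_mono) auto
    moreover have "p * (2 - \<epsilon>\<^sup>2 * p) - q * (2 - \<epsilon>\<^sup>2 * q) = (p - q) * (2 - \<epsilon>\<^sup>2 * p - \<epsilon>\<^sup>2 * q)"
      by (simp add: algebra_simps)
    ultimately have "\<bar>p * (2 - \<epsilon>\<^sup>2 * p) - q * (2 - \<epsilon>\<^sup>2 * q)\<bar> \<le> 2 * \<eta>"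
      by (simp add: abs_mult)
    \<comment> \<open>The radicands vanish at the ends of the humps, so the root is only Hoelder
      continuous of exponent 1/2 there.\<close>
    moreover have "\<bar>sqrt (p * (2 - \<epsilon>\<^sup>2 * p)) - sqrt (q * (2 - \<epsilon>\<^sup>2 * q))\<bar>
        \<le> sqrt \<bar>p * (2 - \<epsilon>\<^sup>2 * p) - q * (2 - \<epsilon>\<^sup>2 * q)\<bar>"
      using p q by (intro abs_diff_sqrt_le mult_nonneg_nonneg) auto
    ultimately show ?thesis
      unfolding p_def q_def by (meson order_trans real_sqrt_le_mono)
  qed
  have "norm (transition_cost \<epsilon> \<sigma> b a c - transition_cost \<epsilon> \<tau> d a' c') \<le> sqrt (2 * \<eta>) * measure lborel {0..M}"
    by (rule has_integral_bound_real
        [OF _ finite.emptyI has_integral_diff [OF transition_cost_profile [OF 1 M(1)] transition_cost_profile [OF 2 M(2)]]])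
      (use bound \<open>0 \<le> \<eta>\<close> in auto)
  then show ?thesis
    using \<open>0 \<le> M\<close> by (simp add: mult.commute)
qed

section \<open>Range and energy of a simple solution\<close>

context
  fixes \<epsilon> r \<sigma> b :: real and z :: "real \<Rightarrow> real"
  assumes \<epsilon>: "0 < \<epsilon>" and sol: "simple_solution_with_pair F A B \<epsilon> r z (\<sigma>, b)"
begin

abbreviation (input) "I \<equiv> {-1/\<epsilon>..1/\<epsilon>}"
abbreviation (input) "z_left \<equiv> z (-1/\<epsilon>)"
abbreviation (input) "z_right \<equiv> z (1/\<epsilon>)"

lemma endpoints_less: "-1/\<epsilon> < 1/\<epsilon>"
  using \<epsilon> by (simp add: field_simps)

lemma solution_pos: "t \<in> I \<Longrightarrow> 0 < z t"
  using sol by (auto simp: simple_solution_with_pair_def simple_solution_def solution_def)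

lemma mono_solution: "mono_on I z"
  using sol by (auto simp: simple_solution_with_pair_def simple_solution_def)

lemma differentiable_solution: "t \<in> {-1/\<epsilon><..<1/\<epsilon>} \<Longrightarrow> z differentiable (at t)"
  using sol unfolding simple_solution_with_pair_def simple_solution_def solution_def by blast

lemma DERIV_solution: "t \<in> {-1/\<epsilon><..<1/\<epsilon>} \<Longrightarrow> (z has_real_derivative deriv z t) (at t)"
  by (simp only: DERIV_deriv_iff_real_differentiable differentiable_solution)

lemma Neumann: "t = -1/\<epsilon> \<or> t = 1/\<epsilon> \<Longrightarrow> (z has_real_derivative 0) (at t within I)"
  using sol unfolding simple_solution_with_pair_def simple_solution_def solution_def by blast

lemma first_integral: "t \<in> {-1/\<epsilon><..<1/\<epsilon>} \<Longrightarrow> Pfun \<epsilon> (deriv z t) = \<Phi> \<sigma> (z t) - b"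
  using sol unfolding simple_solution_with_pair_def by blast

lemma mass: "(z has_integral 2 * r / \<epsilon>) I"
  using sol unfolding simple_solution_with_pair_def simple_solution_def solution_def by blast

lemma continuous_on_solution: "continuous_on I z"
  unfolding continuous_on_eq_continuous_within
proof
  fix t assume "t \<in> I"
  with atLeastAtMost_cases [of t "-1/\<epsilon>" "1/\<epsilon>"] consider "t \<in> {-1/\<epsilon><..<1/\<epsilon>}" | "t = -1/\<epsilon> \<or> t = 1/\<epsilon>"
    by blast
  then show "continuous (at t within I) z"
    by cases (blast intro: continuous_at_imp_continuous_at_within DERIV_isCont DERIV_solution
        DERIV_continuous Neumann)+
qed

lemma deriv_solution_nonneg:
  assumes "t \<in> {-1/\<epsilon><..<1/\<epsilon>}"
  shows "0 \<le> deriv z t"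
  by (rule mono_on_imp_deriv_nonneg [OF mono_solution DERIV_solution [OF assms]])
    (use assms in \<open>simp only: interior_atLeastAtMost_real\<close>)

text \<open>The first integral is given only on the open interval. If \<open>h t0\<close> were
  nonzero, continuity would keep \<open>h\<close> away from 0 near \<open>t0\<close>, while nearby
  points of small slope force \<open>h\<close>, which equals \<open>Pfun\<close> of the slope, to be
  small.\<close>

lemma Phi_at_endpoint:
  assumes t0: "t0 = -1/\<epsilon> \<or> t0 = 1/\<epsilon>"
  shows "\<Phi> \<sigma> (z t0) = b"
proof (rule ccontr)
  assume ne: "\<Phi> \<sigma> (z t0) \<noteq> b"
  define h where "h = (\<lambda>t. \<Phi> \<sigma> (z t) - b)"
  have "continuous_on I h"
    unfolding h_def using solution_pos
    by (intro continuous_intros continuous_on_compose2 [OF continuous_on_Phi [OF order_refl] continuous_on_solution])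
      auto
  moreover have "t0 \<in> I"
    using t0 endpoints_less by auto
  moreover have "\<bar>h t0\<bar> / 2 > 0"
    using ne by (simp add: h_def)
  ultimately obtain d where "d > 0"
    and d: "\<And>t. t \<in> I \<Longrightarrow> dist t t0 < d \<Longrightarrow> dist (h t) (h t0) < \<bar>h t0\<bar> / 2"
    unfolding continuous_on_iff by metis
  \<comment> \<open>The bound \<open>d\<close> serves continuity; the other two give
    \<open>e\<^sup>2 \<le> e \<le> \<bar>h t0\<bar> / 2\<close>, which dominates \<open>Pfun\<close>
    at \<open>\<xi>\<close>.\<close>
  define e where "e = min d (min 1 (\<bar>h t0\<bar> / 2))"
  have e: "0 < e" "e \<le> d" "e \<le> 1" "e \<le> \<bar>h t0\<bar> / 2"
    using \<open>d > 0\<close> \<open>\<bar>h t0\<bar> / 2 > 0\<close> by (auto simp: e_def)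
  obtain \<xi> where \<xi>: "\<xi> \<in> {-1/\<epsilon><..<1/\<epsilon>}" "\<bar>\<xi> - t0\<bar> < e" "\<bar>deriv z \<xi>\<bar> < e"
    by (rule exists_small_deriv_near_endpoint [OF endpoints_less t0 Neumann [OF t0]
          continuous_on_solution differentiable_solution \<open>0 < e\<close>])
  have "h \<xi> = Pfun \<epsilon> (deriv z \<xi>)"
    using first_integral [OF \<xi>(1)] by (simp add: h_def)
  moreover have "(deriv z \<xi>)\<^sup>2 \<le> e\<^sup>2"
    using \<xi>(3) by (simp add: abs_le_square_iff [symmetric])
  moreover have "e\<^sup>2 \<le> e"
    using e by (simp add: power2_eq_square mult_left_le)
  ultimately have "\<bar>h \<xi>\<bar> \<le> \<bar>h t0\<bar> / 2"
    using Pfun_le_square [OF \<epsilon>, of "deriv z \<xi>"] Pfun_nonneg [of \<epsilon> "deriv z \<xi>"] e by simp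
  moreover have "dist (h \<xi>) (h t0) < \<bar>h t0\<bar> / 2"
    using \<xi> e by (intro d) (auto simp: dist_real_def)
  ultimately show False
    unfolding dist_real_def by linarith
qed

lemma range_bounds: "t \<in> I \<Longrightarrow> z t \<in> {z_left..z_right}"
  using mono_solution endpoints_less by (auto simp: mono_on_def)

lemma range_solution:
  assumes "x \<in> {z_left..z_right}"
  obtains t where "t \<in> I" "z t = x"
  using IVT' [of z "-1/\<epsilon>" x "1/\<epsilon>"] assms continuous_on_solution endpoints_less by fastforce

lemma endpoint_values_less: "z_left < z_right"
proof (rule ccontr)
  assume "\<not> z_left < z_right"
  then have "\<forall>t\<in>I. z t = z_left"
    using range_bounds by fastforce
  then have "z constant_on I"
    unfolding constant_on_def by blast
  then show False
    using sol by (auto simp: simple_solution_with_pair_def simple_solution_def)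
qed

text \<open>Every such \<open>x\<close> is a value of \<open>z\<close>, so the bounds on
  \<open>Pfun\<close> pass through the first integral.\<close>

lemma Phi_range:
  assumes "x \<in> {z_left..z_right}"
  shows "b \<le> \<Phi> \<sigma> x" "\<epsilon>\<^sup>2 * (\<Phi> \<sigma> x - b) \<le> 1"
proof -
  obtain t where "t \<in> I" and x: "x = z t"
    using range_solution [OF assms] by metis
  with atLeastAtMost_cases [of t "-1/\<epsilon>" "1/\<epsilon>"] consider "t \<in> {-1/\<epsilon><..<1/\<epsilon>}" | "t = -1/\<epsilon> \<or> t = 1/\<epsilon>"
    by blast
  then have "b \<le> \<Phi> \<sigma> x \<and> \<epsilon>\<^sup>2 * (\<Phi> \<sigma> x - b) \<le> 1"
  proof cases
    case 1
    then show ?thesis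
      using first_integral [OF 1] Pfun_less [OF \<epsilon>, of "deriv z t"] Pfun_nonneg [of \<epsilon> "deriv z t"]
      by (simp add: x)
  next
    case 2
    then show ?thesis
      using Phi_at_endpoint by (simp add: x)
  qed
  then show "b \<le> \<Phi> \<sigma> x" "\<epsilon>\<^sup>2 * (\<Phi> \<sigma> x - b) \<le> 1"
    by auto
qed

text \<open>The range avoids \<open>\<alpha> \<sigma>\<close> and \<open>\<beta> \<sigma>\<close>,
  where the potential is below \<open>b\<close>. Since the potential equals \<open>b\<close> at both
  ends, the range cannot lie in a single interval of monotonicity; hence it lies between the wells
  and contains \<open>\<zeta> \<sigma>\<close>.\<close>

lemma hump_solution: "hump \<sigma> b z_left z_right"
proof -
  have \<sigma>: "\<sigma> \<in> S" and b: "\<Phi> \<sigma> (\<alpha> \<sigma>) < b" "\<Phi> \<sigma> (\<beta> \<sigma>) < b"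
    using sol by (auto simp: simple_solution_with_pair_def admissible_def)
  have ends: "\<Phi> \<sigma> z_left = b" "\<Phi> \<sigma> z_right = b"
    using Phi_at_endpoint by auto
  have pos: "0 < z_left"
    using solution_pos endpoints_less by simp
  have "\<alpha> \<sigma> \<notin> {z_left..z_right}" "\<beta> \<sigma> \<notin> {z_left..z_right}"
    using Phi_range(1) b by (meson not_le)+
  moreover have "\<alpha> \<sigma> < z_right"
    using Phi_less_left [OF \<sigma> pos endpoint_values_less] ends by force
  moreover have "z_left < \<beta> \<sigma>"
    using Phi_less_right [OF \<sigma> _ endpoint_values_less] ends by force
  moreover have "z_left \<le> \<zeta> \<sigma>" if "z_right < \<beta> \<sigma>"
    using Phi_less_mid_right [OF \<sigma> _ endpoint_values_less] ends that by force
  moreover have "\<zeta> \<sigma> \<le> z_right" if "\<alpha> \<sigma> < z_left"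
    using Phi_less_mid_left [OF \<sigma> _ endpoint_values_less] ends that by force
  ultimately show ?thesis
    using \<sigma> ends by (auto simp: hump_def)
qed

text \<open>The substitution \<open>s = z t\<close> is carried out through the antiderivative
  \<open>J\<close> of \<open>H\<close>: the product \<open>H (z t) * deriv z t\<close> is the
  derivative of \<open>J \<circ> z\<close>. The affine remainder integrates by the mass
  constraint.\<close>

lemma energy_solution:
  "energy F \<epsilon> z = 2 * (\<sigma> * r + b) + \<epsilon> * transition_cost \<epsilon> \<sigma> b z_left z_right"
proof -
  define H where "H = (\<lambda>s. sqrt ((\<Phi> \<sigma> s - b) * (2 - \<epsilon>\<^sup>2 * (\<Phi> \<sigma> s - b))))"
  define J where "J = (\<lambda>x. integral {z_left..x} H)"
  have "{z_left..z_right} \<subseteq> {0<..}"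
    using solution_pos [of "-1/\<epsilon>"] endpoints_less by auto
  then have "continuous_on {z_left..z_right} H"
    unfolding H_def by (intro continuous_intros continuous_on_Phi)
  then have J: "(J has_real_derivative H x) (at x within {z_left..z_right})"
    if "x \<in> {z_left..z_right}" for x
    unfolding J_def using that by (rule integral_has_real_derivative)
  have integral_J: "((\<lambda>t. H (z t) * deriv z t) has_integral J z_right - J z_left) I"
  proof (rule fundamental_theorem_of_calculus_interior [of _ _ "J \<circ> z", unfolded o_apply])
    show "continuous_on I (\<lambda>t. J (z t))"
    proof (rule continuous_on_compose2 [OF _ continuous_on_solution])
      show "continuous_on {z_left..z_right} J"
        using J by (rule DERIV_continuous_on)
    qed (use range_bounds in blast)
    fix t assume t: "t \<in> {-1/\<epsilon><..<1/\<epsilon>}"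
    then have tI: "t \<in> I" by simp
    \<comment> \<open>\<open>J\<close> is differentiable only relative to the range of
      \<open>z\<close>, so the chain rule is applied within the interval, and the restriction is
      dropped at interior points.\<close>
    have "(J has_real_derivative H (z t)) (at (z t) within z ` I)"
      using range_bounds by (intro DERIV_subset [OF J]) (use tI in blast)+
    then have "(J \<circ> z has_real_derivative H (z t) * deriv z t) (at t within I)"
      using DERIV_solution [OF t] by (intro DERIV_image_chain) (auto intro: has_field_derivative_at_within)
    moreover have "at t within I = at t"
      using t by (intro at_within_interior) (simp only: interior_atLeastAtMost_real)
    ultimately show "((\<lambda>t. J (z t)) has_vector_derivative H (z t) * deriv z t) (at t)"
      by (simp add: has_real_derivative_iff_has_vector_derivative o_def)
  qed (use endpoints_less in simp)
  have J_diff: "J z_right - J z_left = transition_cost \<epsilon> \<sigma> b z_left z_right"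
    by (simp add: J_def H_def transition_cost_def)
  have "((\<lambda>t. \<sigma> * z t + b) has_integral \<sigma> * (2 * r / \<epsilon>) + measure lborel I *\<^sub>R b) I"
    using has_integral_const_real [of b "-1/\<epsilon>" "1/\<epsilon>"]
    by (intro has_integral_add has_integral_mult_right mass)
  moreover have "measure lborel I = 2 / \<epsilon>"
    using \<epsilon> by simp
  ultimately have linear_part: "((\<lambda>t. \<sigma> * z t + b) has_integral \<sigma> * (2 * r / \<epsilon>) + 2 / \<epsilon> * b) I"
    by simp
  have "((\<lambda>t. H (z t) * deriv z t + (\<sigma> * z t + b))
      has_integral transition_cost \<epsilon> \<sigma> b z_left z_right + (\<sigma> * (2 * r / \<epsilon>) + 2 / \<epsilon> * b)) I"
    by (rule has_integral_add [OF integral_J [unfolded J_diff] linear_part])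
  then have "((\<lambda>t. Qfun (\<epsilon> * deriv z t) / \<epsilon>\<^sup>2 + F (z t))
      has_integral transition_cost \<epsilon> \<sigma> b z_left z_right + (\<sigma> * (2 * r / \<epsilon>) + 2 / \<epsilon> * b)) I"
  \<comment> \<open>At the two endpoints the two-sided \<open>deriv z\<close> is uncontrolled, so
    they form the exceptional set.\<close>
  proof (rule has_integral_spike_finite [of "{-1/\<epsilon>, 1/\<epsilon>}", rotated 2])
    fix t assume "t \<in> I - {-1/\<epsilon>, 1/\<epsilon>}"
    then have t: "t \<in> {-1/\<epsilon><..<1/\<epsilon>}" by fastforce
    show "Qfun (\<epsilon> * deriv z t) / \<epsilon>\<^sup>2 + F (z t) = H (z t) * deriv z t + (\<sigma> * z t + b)"
      using Qfun_eq_Pfun [OF \<epsilon> deriv_solution_nonneg [OF t]]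
      by (simp add: first_integral [OF t] H_def mult.commute) (simp add: Phi_def)
  qed simp
  then have "energy F \<epsilon> z = \<epsilon> * (transition_cost \<epsilon> \<sigma> b z_left z_right + (\<sigma> * (2 * r / \<epsilon>) + 2 / \<epsilon> * b))"
    unfolding energy_def by (simp only: integral_unique)
  also have "\<dots> = 2 * (\<sigma> * r + b) + \<epsilon> * transition_cost \<epsilon> \<sigma> b z_left z_right"
    using \<epsilon> by (simp add: field_simps)
  finally show ?thesis .
qed

end

section \<open>Comparison of the energy with its Maxwell value\<close>

lemma c_coeff_eq: "c_coeff F A B \<epsilon> = transition_cost \<epsilon> \<sigma>0 (b0 F A B) \<alpha>0 \<beta>0"
proof -
  \<comment> \<open>\<open>b0\<close> is the depth at \<open>\<alpha>0\<close>, while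
    \<open>c_coeff\<close> refers to \<open>\<beta>0\<close>; the equal-depth condition identifies
    the two.\<close>
  have "F s - F \<beta>0 - \<sigma>0 * (s - \<beta>0) = \<Phi> \<sigma>0 s - b0 F A B" for s
    using sigma0(2) by (simp add: b0_def Phi_def algebra_simps)
  then show ?thesis
    by (simp add: c_coeff_def transition_cost_def Let_def)
qed

text \<open>Turns closeness of \<sigma> to \<open>\<sigma>0\<close> into a common upper bound for
  the ranges of the solutions.\<close>

lemma beta_less:
  assumes "\<sigma> \<in> S" "B \<le> M" "\<sigma> < F' M"
  shows "\<beta> \<sigma> < M"
  using F'_less_right [of M "\<beta> \<sigma>"] beta_at [OF \<open>\<sigma> \<in> S\<close>] assms
  by (cases M "\<beta> \<sigma>" rule: linorder_cases) auto

text \<open>The error splits into a part affine in the pair and \<epsilon> times a difference of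
  transition costs. Both the affine part and the potentials vary by at most a multiple of \<rho> on
  \<open>{0..M}\<close>, where \<open>M\<close> bounds \<open>r\<close> and both ranges.\<close>

lemma energy_estimate:
  assumes \<epsilon>: "0 < \<epsilon>" "\<epsilon> \<le> 1"
    and sol: "simple_solution_with_pair F A B \<epsilon> r z (\<sigma>, b)"
    and dist: "dist (\<sigma>, b) (Delta0 F A B) \<le> \<rho>"
    and M: "\<beta>0 \<le> M" "\<sigma>0 + \<rho> < F' M"
    and r: "0 \<le> r" "r \<le> M"
    and small: "\<And>s. s \<in> {\<alpha>0..\<beta>0} \<Longrightarrow> \<epsilon>\<^sup>2 * (\<Phi> \<sigma>0 s - b0 F A B) \<le> 1"
  shows "\<bar>energy F \<epsilon> z - (2 * (\<sigma>0 * r + b0 F A B) + \<epsilon> * c_coeff F A B \<epsilon>)\<bar>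
           \<le> 2 * (M + 1) * \<rho> + M * sqrt (2 * ((M + 1) * \<rho>))"
proof -
  let ?b0 = "b0 F A B"
  have \<rho>: "\<bar>\<sigma> - \<sigma>0\<bar> \<le> \<rho>" "\<bar>b - ?b0\<bar> \<le> \<rho>"
    using dist dist_fst_le [of "(\<sigma>, b)" "Delta0 F A B"] dist_snd_le [of "(\<sigma>, b)" "Delta0 F A B"]
    by (auto simp: Delta0_def dist_real_def)
  then have "0 \<le> \<rho>" by linarith
  have linear: "\<bar>(\<sigma> - \<sigma>0) * s\<bar> + \<bar>b - ?b0\<bar> \<le> (M + 1) * \<rho>" if "0 \<le> s" "s \<le> M" for s
  proof -
    have "\<bar>(\<sigma> - \<sigma>0) * s\<bar> \<le> \<rho> * M"
      using \<rho> that \<open>0 \<le> \<rho>\<close> unfolding abs_mult by (intro mult_mono) auto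
    with \<rho>(2) show ?thesis by (simp add: algebra_simps)
  qed
  let ?cost = "transition_cost \<epsilon> \<sigma> b (z (-1/\<epsilon>)) (z (1/\<epsilon>))"
    and ?cost_Maxwell = "transition_cost \<epsilon> \<sigma>0 ?b0 \<alpha>0 \<beta>0"
  note hump = hump_solution [OF \<epsilon>(1) sol]
  have "B \<le> M"
    using M(1) hump_Maxwell beta_at [of \<sigma>0] by (auto simp: hump_def beta0_def)
  moreover have "\<sigma> < F' M"
    using \<rho>(1) M(2) by linarith
  ultimately have "z (1/\<epsilon>) \<le> M"
    using beta_less [of \<sigma> M] hump by (auto simp: hump_def)
  moreover have "0 \<le> M"
    using \<open>B \<le> M\<close> A_pos A_less_B by linarith
  moreover have "\<bar>(\<Phi> \<sigma> s - b) - (\<Phi> \<sigma>0 s - ?b0)\<bar> \<le> (M + 1) * \<rho>" if "s \<in> {0<..M}" for s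
    using linear [of s] that by (simp add: Phi_def algebra_simps)
  ultimately have "\<bar>?cost - ?cost_Maxwell\<bar> \<le> M * sqrt (2 * ((M + 1) * \<rho>))"
    using Phi_range(2) [OF \<epsilon>(1) sol] \<open>0 \<le> \<rho>\<close>
    by (intro abs_transition_cost_diff_le [OF hump hump_Maxwell _ M(1)] small) auto
  moreover have "\<bar>\<epsilon> * (?cost - ?cost_Maxwell)\<bar> \<le> \<bar>?cost - ?cost_Maxwell\<bar>"
    using \<epsilon> by (simp add: abs_mult mult_left_le_one_le)
  ultimately have cost: "\<bar>\<epsilon> * (?cost - ?cost_Maxwell)\<bar> \<le> M * sqrt (2 * ((M + 1) * \<rho>))"
    by linarith
  have "energy F \<epsilon> z - (2 * (\<sigma>0 * r + ?b0) + \<epsilon> * c_coeff F A B \<epsilon>)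
      = 2 * ((\<sigma> - \<sigma>0) * r) + 2 * (b - ?b0) + \<epsilon> * (?cost - ?cost_Maxwell)"
    unfolding energy_solution [OF \<epsilon>(1) sol] c_coeff_eq by (simp add: algebra_simps)
  moreover have "\<bar>2 * x + 2 * y + w\<bar> \<le> 2 * p + q" if "\<bar>x\<bar> + \<bar>y\<bar> \<le> p" "\<bar>w\<bar> \<le> q" for x y w p q :: real
    using that by linarith
  ultimately show ?thesis
    using linear [OF r] cost by (simp only: mult.assoc)
qed

end

section \<open>Thresholds on \<epsilon> and the exponential error bound\<close>

theorem proposition1:
  fixes F :: "real \<Rightarrow> real" and A B \<delta> \<epsilon>\<^sub>\<delta> :: real and N :: "(real \<times> real) set"
    and z :: "real \<Rightarrow> real \<Rightarrow> real \<Rightarrow> real"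
  assumes "double_well F A B"
    and "\<delta> \<in> {0<..<(beta0 F A B - alpha0 F A B) / 2}"
    and "maxwell_nbhd F A B \<delta> \<epsilon>\<^sub>\<delta> N"
    and "\<forall>\<epsilon>\<in>{0<..<\<epsilon>\<^sub>\<delta>}. \<forall>r\<in>R_set F A B \<delta>. maxwell_solution F A B N \<epsilon> r (z \<epsilon> r)"
  shows "\<exists>C>0. \<exists>K. \<forall>\<^sub>F \<epsilon> in at_right 0. \<forall>r\<in>R_set F A B \<delta>.
    \<bar>energy F \<epsilon> (z \<epsilon> r) -
      (2 * (sigma0 F A B * r + b0 F A B) + \<epsilon> * c_coeff F A B \<epsilon>)\<bar> \<le> K * exp (- C / \<epsilon>)"
proof -
  interpret double_well_potential F A B
    by unfold_locales fact
  obtain C K' where "C > 0" and close: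
    "\<forall>\<^sub>F \<epsilon> in at_right 0. \<forall>r\<in>R_set F A B \<delta>. \<forall>z. \<forall>\<Delta>\<in>N.
        simple_solution_with_pair F A B \<epsilon> r z \<Delta> \<longrightarrow> dist \<Delta> (Delta0 F A B) \<le> K' * exp (- C / \<epsilon>)"
    and "0 < \<epsilon>\<^sub>\<delta>"
    using assms(3) unfolding maxwell_nbhd_def by blast
  \<comment> \<open>The sign of \<open>K'\<close> is not prescribed; nonnegativity is used in the
    final estimate.\<close>
  define K where "K = \<bar>K'\<bar>"
  \<comment> \<open>Any point beyond \<open>\<beta>0\<close> has \<open>F' M > \<sigma>0\<close>,
    which leaves room for pairs near the Maxwell point.\<close>
  define M where "M = \<beta>0 + 1"
  have \<sigma>0: "\<sigma>0 \<in> S" using sigma0(1) by auto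
  have \<beta>0: "B \<le> \<beta>0" "F' \<beta>0 = \<sigma>0" and \<alpha>0: "0 < \<alpha>0"
    using beta_at [OF \<sigma>0] alpha_at [OF \<sigma>0] by (auto simp: beta0_def alpha0_def)
  have F'_M: "0 < F' M - \<sigma>0"
    using F'_less_right [of \<beta>0 M] \<beta>0 by (simp add: M_def)
  have "{\<alpha>0..\<beta>0} \<subseteq> {0<..}" using \<alpha>0 by auto
  then have "continuous_on {\<alpha>0..\<beta>0} (\<lambda>s. \<Phi> \<sigma>0 s - b0 F A B)"
    by (intro continuous_intros continuous_on_Phi)
  then have "bounded ((\<lambda>s. \<Phi> \<sigma>0 s - b0 F A B) ` {\<alpha>0..\<beta>0})"
    by (intro compact_imp_bounded compact_continuous_image) auto
  \<comment> \<open>For the Maxwell potential no first integral is at hand, so smallness of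
    \<epsilon> against \<open>D\<close> replaces the bound of \<open>Phi_range\<close>.\<close>
  then obtain D where D: "D > 0" "\<And>s. s \<in> {\<alpha>0..\<beta>0} \<Longrightarrow> \<bar>\<Phi> \<sigma>0 s - b0 F A B\<bar> \<le> D"
    unfolding bounded_pos by auto
  \<comment> \<open>Sum of the coefficients of the two error terms: the root halves the rate
    \<open>C\<close>, and the linear term decays faster.\<close>
  define L where "L = 2 * (M + 1) * K + M * sqrt (2 * ((M + 1) * K))"
  have exp_0: "((\<lambda>\<epsilon>. K * exp (- C / \<epsilon>)) \<longlongrightarrow> 0) (at_right 0)"
  proof -
    have "filterlim (\<lambda>\<epsilon>. - C / \<epsilon>) at_bot (at_right 0)"
      using \<open>C > 0\<close> filterlim_tendsto_neg_mult_at_bot [OF tendsto_const _ filterlim_inverse_at_top_right, of "- C"]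
      by (simp add: divide_inverse)
    then show ?thesis
      by (intro tendsto_mult_right_zero filterlim_compose [OF exp_at_bot])
  qed
  have sq_0: "((\<lambda>\<epsilon>. \<epsilon>\<^sup>2 * D) \<longlongrightarrow> 0) (at_right 0)"
    by (intro tendsto_eq_intros | simp)+
  \<comment> \<open>None of the four conditions on \<epsilon> depends on a choice of
    \<open>r\<close>, hence the uniformity.\<close>
  have "\<forall>\<^sub>F \<epsilon> in at_right 0. \<epsilon> \<in> {0<..<min 1 \<epsilon>\<^sub>\<delta>}"
    using \<open>0 < \<epsilon>\<^sub>\<delta>\<close> by (intro eventually_at_right_real) simp
  moreover note close
  moreover have "\<forall>\<^sub>F \<epsilon> in at_right 0. K * exp (- C / \<epsilon>) < F' M - \<sigma>0"
    using exp_0 F'_M by (rule order_tendstoD)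
  moreover have "\<forall>\<^sub>F \<epsilon> in at_right 0. \<epsilon>\<^sup>2 * D < 1"
    using sq_0 by (rule order_tendstoD) simp
  ultimately have "\<forall>\<^sub>F \<epsilon> in at_right 0. \<forall>r\<in>R_set F A B \<delta>.
    \<bar>energy F \<epsilon> (z \<epsilon> r) - (2 * (\<sigma>0 * r + b0 F A B) + \<epsilon> * c_coeff F A B \<epsilon>)\<bar> \<le> L * exp (- (C/2) / \<epsilon>)"
  proof eventually_elim
    case (elim \<epsilon>)
    show ?case
    proof
      fix r assume r: "r \<in> R_set F A B \<delta>"
      define \<rho> where "\<rho> = K * exp (- C / \<epsilon>)"
      have \<epsilon>: "0 < \<epsilon>" "\<epsilon> < 1" "\<epsilon> < \<epsilon>\<^sub>\<delta>" using elim(1) by auto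
      then obtain \<sigma> b where "(\<sigma>, b) \<in> N"
        and sol: "simple_solution_with_pair F A B \<epsilon> r (z \<epsilon> r) (\<sigma>, b)"
        using assms(4) r by (fastforce simp: maxwell_solution_def)
      then have "dist (\<sigma>, b) (Delta0 F A B) \<le> K' * exp (- C / \<epsilon>)"
        using elim(2) r by blast
      also have "\<dots> \<le> \<rho>"
        by (simp add: \<rho>_def K_def)
      finally have dist: "dist (\<sigma>, b) (Delta0 F A B) \<le> \<rho>" .
      have "\<epsilon>\<^sup>2 * (\<Phi> \<sigma>0 s - b0 F A B) \<le> 1" if "s \<in> {\<alpha>0..\<beta>0}" for s
      proof -
        have "\<epsilon>\<^sup>2 * (\<Phi> \<sigma>0 s - b0 F A B) \<le> \<epsilon>\<^sup>2 * D"
          using D(2) [OF that] by (intro mult_left_mono) auto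
        with elim(4) show ?thesis by linarith
      qed
      then have "\<bar>energy F \<epsilon> (z \<epsilon> r) - (2 * (\<sigma>0 * r + b0 F A B) + \<epsilon> * c_coeff F A B \<epsilon>)\<bar>
          \<le> 2 * (M + 1) * \<rho> + M * sqrt (2 * ((M + 1) * \<rho>))"
        using \<epsilon> elim(3) r assms(2) \<alpha>0
        by (intro energy_estimate [OF \<open>0 < \<epsilon>\<close> _ sol dist]) (auto simp: \<rho>_def M_def R_set_def)
      also have "\<dots> \<le> L * exp (- (C/2) / \<epsilon>)"
      proof -
        have M: "0 \<le> M" "0 \<le> K"
          using \<beta>0 A_pos A_less_B by (auto simp: M_def K_def)
        have half: "exp (- C / \<epsilon>) = (exp (- (C/2) / \<epsilon>))\<^sup>2"
          by (simp flip: exp_double)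
        have "2 * ((M + 1) * \<rho>) = 2 * ((M + 1) * K) * (exp (- (C/2) / \<epsilon>))\<^sup>2"
          unfolding \<rho>_def half by (simp only: mult.assoc)
        then have "sqrt (2 * ((M + 1) * \<rho>)) = sqrt (2 * ((M + 1) * K)) * exp (- (C/2) / \<epsilon>)"
          by (simp only: real_sqrt_mult real_sqrt_abs abs_exp_cancel)
        moreover have "exp (- C / \<epsilon>) \<le> exp (- (C/2) / \<epsilon>)"
          using \<epsilon> \<open>C > 0\<close> by (simp add: frac_le)
        then have "2 * (M + 1) * \<rho> \<le> 2 * (M + 1) * (K * exp (- (C/2) / \<epsilon>))"
          unfolding \<rho>_def using M by (intro mult_left_mono) auto
        ultimately show ?thesis
          by (simp add: L_def algebra_simps)
      qed
      finally show "\<bar>energy F \<epsilon> (z \<epsilon> r) - (2 * (\<sigma>0 * r + b0 F A B) + \<epsilon> * c_coeff F A B \<epsilon>)\<bar>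
          \<le> L * exp (- (C/2) / \<epsilon>)" .
    qed
  qed
  then show ?thesis
    using \<open>C > 0\<close> by (intro exI [of _ "C/2"] conjI exI [of _ L]) auto
qed

end
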